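(* Consider the secondary link described in the context, with interference-plus-noise covariance matrix $\mathbf{Q}=\mathbf{H}_{21}\mathbf{V}_{H_{11}}\mathbf{P}_1\mathbf{V}_{H_{11}}^H\mathbf{H}_{21}^H+\sigma_2^2\mathbf{I}_{N_2}$ and interference-alignment pre-processing matrix $\mathbf{V}_2$ (of size $M_2\times L_2$, with orthonormal columns). Consider the problem of finding the input covariance matrix $\mathbf{P}_2$ ($L_2\times L_2$) which maximizes the achievable transmission rate of the secondary link: $$\max_{\mathbf{P}_2}\ \log_2\left|\mathbf{I}_{N_2}+\mathbf{Q}^{-1/2}\mathbf{H}_{22}\mathbf{V}_2\mathbf{P}_2\mathbf{V}_2^H\mathbf{H}_{22}^H\mathbf{Q}^{-1/2}\right|\quad\text{subject to}\quad \mathrm{Trace}(\mathbf{V}_2\mathbf{P}_2\mathbf{V}_2^H)\le M_2\,p_{2,\max}.$$ Let $\mathbf{K}=\mathbf{Q}^{-1/2}\mathbf{H}_{22}\mathbf{V}_2$ ($N_2\times L_2$), let $\mathbf{K}=\mathbf{U}_K\boldsymbol{\Lambda}_K\mathbf{V}_K^H$ be a singular value decomposition with $\mathbf{U}_K$ ($N_2\times N_2$) and $\mathbf{V}_K$ ($L_2\times L_2$) unitary and $\boldsymbol{\Lambda}_K$ an $N_2\times L_2$ matrix with at most $\min(N_2,L_2)$ non-zero singular values on its main diagonal and zeros elsewhere, and let $\boldsymbol{\Lambda}_K^H\boldsymbol{\Lambda}_K=\mathrm{diag}(\lambda_{K^HK,1},\ldots,\lambda_{K^HK,L_2})$. Put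 $\tilde{\mathbf{P}}_2=\mathbf{V}_K^H\mathbf{P}_2\mathbf{V}_K$, with main diagonal entries $\tilde p_{2,1},\ldots,\tilde p_{2,L_2}$. Then choosing $\tilde{\mathbf{P}}_2$ diagonal maximizes the transmission rate, and the problem simplifies to $$\max_{\tilde p_{2,1},\ldots,\tilde p_{2,L_2}}\ \sum_{n=1}^{L_2}\log_2\left(1+\lambda_{K^HK,n}\,\tilde p_{2,n}\right)\quad\text{subject to}\quad\sum_{n=1}^{L_2}\tilde p_{2,n}\le M_2\,p_{2,\max},$$ which has the water-filling solution $$\tilde p_{2,n}=\left(\beta_2-\frac{1}{\lambda_{K^HK,n}}\right)^+,\qquad n=1,\ldots,L_2,$$ where the water-level $\beta_2$ is determined to saturate the power constraint $\sum_{n=1}^{L_2}\tilde p_{2,n}\le M_2\,p_{2,\max}$. Accordingly, the optimal power allocation matrix is the diagonal matrix $\mathbf{P}_{2,OPA}=\mathrm{diag}(\tilde p_{2,1},\ldots,\tilde p_{2,L_2})$, used together with the pre-processing matrix $\mathbf{V}_{2,OPA}=\mathbf{V}_2\mathbf{V}_K$.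
   Context: Notation. $|\cdot|$ denotes the determinant, $(\cdot)^H$ the conjugate transpose, $(x)^+=\max(0,x)$. Model. Two MIMO links share a band; link 1 is primary, link 2 secondary. For $i,j\in\{1,2\}$, $\mathbf{H}_{ij}$ is the $N_i\times M_j$ channel matrix from transmitter $j$ to receiver $i$, a realization of a random matrix with i.i.d. circularly symmetric complex Gaussian entries of mean $0$ and variance $1/M_j$. $\sigma_1^2,\sigma_2^2$ are the noise variances at the receivers and $p_{1,\max},p_{2,\max}$ the power budgets. Primary configuration. $\mathbf{H}_{11}=\mathbf{U}_{H_{11}}\boldsymbol{\Lambda}_{H_{11}}\mathbf{V}_{H_{11}}^H$ is a singular value decomposition with squared singular values in decreasing order; $\mathbf{P}_1=\mathrm{diag}(p_{1,1},\ldots,p_{1,M_1})$ with $p_{1,n}=(\beta-\sigma_1^2/\lambda_n)^+$, where $\lambda_1,\ldots,\lambda_{M_1}$ are the diagonal entries of $\boldsymbol{\Lambda}_{H_{11}}^H\boldsymbol{\Lambda}_{H_{11}}$ ($p_{1,n}=0$ if $\lambda_n=0$) and $\beta$ is set so that $\sum_np_{1,n}=M_1p_{1,\max}$. Let $m_1$ be the number of indices $n$ with $p_{1,n}>0$. Secondary configuration. $\tilde{\mathbf{H}}_1$ is the $m_1\times M_2$ matrix made of the first $m_1$ rows of $\mathbf{U}_{H_{11}}^H\mathbf{H}_{12}$; $L_2=\dim\ker\tilde{\mathbf{H}}_1$; $\mathbf{V}_2$ is an $M_2\times L_2$ matrix whose columns form an orthonormal basis of $\ker\tilde{\mathbf{H}}_1$,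 so that $\mathbf{V}_2^H\mathbf{V}_2=\mathbf{I}_{L_2}$ (this guarantees that the primary link is not disturbed). The secondary receiver uses the whitening post-processing matrix $\mathbf{D}_2=\mathbf{Q}^{-1/2}$. *)

theory Defs
  imports
    "Jordan_Normal_Form.Schur_Decomposition"
    "Jordan_Normal_Form.Matrix_Kernel"
begin

abbreviation conj_transpose :: "complex mat \<Rightarrow> complex mat" (\<open>_\<^sup>H\<close> [1000] 1000)
  where "A\<^sup>H \<equiv> mat_adjoint A"

definition mat_trace :: "complex mat \<Rightarrow> complex"
  where "mat_trace A = (\<Sum>i<dim_row A. A $$ (i, i))"

definition unitary_mat :: "nat \<Rightarrow> complex mat \<Rightarrow> bool"
  where "unitary_mat n U \<longleftrightarrow> U \<in> carrier_mat n n \<and> U\<^sup>H * U = 1\<^sub>m n \<and> U * U\<^sup>H = 1\<^sub>m n"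

text \<open>Taking the real part below is harmless: the form of a Hermitian matrix is real.\<close>

definition psd_mat :: "nat \<Rightarrow> complex mat \<Rightarrow> bool"
  where "psd_mat n A \<longleftrightarrow> A \<in> carrier_mat n n \<and> A\<^sup>H = A \<and>
    (\<forall>v \<in> carrier_vec n. 0 \<le> Re ((A *\<^sub>v v) \<bullet>c v))"

text \<open>\<open>R\<close> is the matrix \<open>Q\<close> to the power \<open>-1/2\<close>, that is, the (unique) positive
  semidefinite Hermitian square root of the inverse of \<open>Q\<close>.\<close>

definition is_inv_sqrt :: "nat \<Rightarrow> complex mat \<Rightarrow> complex mat \<Rightarrow> bool"
  where "is_inv_sqrt n Q R \<longleftrightarrow> psd_mat n R \<and> inverts_mat (R * R) Q \<and> inverts_mat Q (R * R)"

definition is_svd ::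
    "nat \<Rightarrow> nat \<Rightarrow> complex mat \<Rightarrow> complex mat \<Rightarrow> complex mat \<Rightarrow> complex mat \<Rightarrow> bool"
  where "is_svd nr nc A U S V \<longleftrightarrow>
    unitary_mat nr U \<and> unitary_mat nc V \<and> S \<in> carrier_mat nr nc \<and> diagonal_mat S \<and>
    (\<forall>i < min nr nc. S $$ (i, i) \<in> \<real> \<and> 0 \<le> Re (S $$ (i, i))) \<and>
    A = U * S * V\<^sup>H"

text \<open>The diagonal entries of \<open>S\<^sup>H * S\<close>; for \<open>n \<ge> dim_row S\<close> (and \<open>n < dim_col S\<close>) they
  are zero.\<close>

definition gram_diag :: "complex mat \<Rightarrow> nat \<Rightarrow> real"
  where "gram_diag S n = Re ((S\<^sup>H * S) $$ (n, n))"

definition real_diag :: "nat \<Rightarrow> (nat \<Rightarrow> real) \<Rightarrow> complex mat"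
  where "real_diag L p = mat_diag L (\<lambda>n. complex_of_real (p n))"

definition orthonormal_kernel_basis :: "nat \<Rightarrow> complex mat \<Rightarrow> complex mat \<Rightarrow> bool"
  where "orthonormal_kernel_basis M A V \<longleftrightarrow>
    V \<in> carrier_mat M (kernel_dim A) \<and> V\<^sup>H * V = 1\<^sub>m (kernel_dim A) \<and>
    kernel.basis M A (set (cols V))"

text \<open>Power \<open>(\<beta> - c / l)\<^sup>+\<close> of a channel of gain \<open>l \<ge> 0\<close>. A channel of gain zero gets no
  power: this is the limit for \<open>l\<close> tending to 0, but has to be stated separately since
  \<open>c / 0 = 0\<close> in HOL.\<close>

definition water_power :: "real \<Rightarrow> real \<Rightarrow> real \<Rightarrow> real"
  where "water_power \<beta> c l = (if l = 0 then 0 else max 0 (\<beta> - c / l))"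

text \<open>The determinant and the trace below are real for Hermitian \<open>P\<close>, and the
  determinant is at least 1 for positive semidefinite \<open>P\<close>.\<close>

definition tx_rate ::
    "nat \<Rightarrow> complex mat \<Rightarrow> complex mat \<Rightarrow> complex mat \<Rightarrow> complex mat \<Rightarrow> real"
  where "tx_rate N D H V P = log 2 (Re (det (1\<^sub>m N + D * H * V * P * V\<^sup>H * H\<^sup>H * D)))"

text \<open>Input covariance matrices are Hermitian positive semidefinite.\<close>

definition feasible_cov :: "nat \<Rightarrow> complex mat \<Rightarrow> real \<Rightarrow> complex mat \<Rightarrow> bool"
  where "feasible_cov L V B P \<longleftrightarrow> psd_mat L P \<and> Re (mat_trace (V * P * V\<^sup>H)) \<le> B"

definition sum_rate :: "nat \<Rightarrow> (nat \<Rightarrow> real) \<Rightarrow> (nat \<Rightarrow> real) \<Rightarrow> real"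
  where "sum_rate L l p = (\<Sum>n<L. log 2 (1 + l n * p n))"

definition feasible_powers :: "nat \<Rightarrow> real \<Rightarrow> (nat \<Rightarrow> real) \<Rightarrow> bool"
  where "feasible_powers L B p \<longleftrightarrow> (\<forall>n<L. 0 \<le> p n) \<and> (\<Sum>n<L. p n) \<le> B"

end

theory Submission
  imports Defs
begin

text \<open>With \<open>K = U S W\<^sup>H\<close> the rate of \<open>P\<close> is \<open>log 2\<close> of the determinant of the \<open>N \<times> N\<close> matrix
  \<open>1 + S (W\<^sup>H P W) S\<^sup>H\<close>, because determinants are invariant under unitary conjugation. This matrix
  is positive definite, so Hadamard's inequality bounds its determinant by the product of its
  diagonal entries \<open>1 + l n * p n\<close>, where \<open>p\<close> is the diagonal of \<open>W\<^sup>H P W\<close>; the bound is attained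
  if \<open>W\<^sup>H P W\<close> is diagonal. Both \<open>W\<close> and \<open>V\<close> preserve the trace, so the constraint becomes one on
  the sum of the \<open>p n\<close>. The remaining concave problem is solved by bounding the logarithm by its
  tangent, and the water level exists by the intermediate value theorem. The precoder \<open>V W\<close> is
  covered by the same argument, since \<open>K W = U S 1\<^sup>H\<close> is again a singular value decomposition.\<close>

section \<open>Adjoints and the sesquilinear form of a matrix\<close>

lemma index_adjoint [simp]:
  assumes "i < dim_col A" "j < dim_row A"
  shows "A\<^sup>H $$ (i, j) = cnj (A $$ (j, i))"
  using assms by (simp add: mat_adjoint_def mat_of_rows_def)

lemma dim_adjoint [simp]: "dim_row (A\<^sup>H) = dim_col A" "dim_col (A\<^sup>H) = dim_row A"
  by (simp_all add: mat_adjoint_def)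

lemma adjoint_carrier [simp]: "A \<in> carrier_mat n m \<Longrightarrow> A\<^sup>H \<in> carrier_mat m n"
  by (rule carrier_matI) simp_all

lemma adjoint_one [simp]: "(1\<^sub>m n)\<^sup>H = 1\<^sub>m n"
  by (rule eq_matI) auto

lemma adjoint_adjoint [simp]: "(A\<^sup>H)\<^sup>H = A"
  by (rule eq_matI) auto

lemma adjoint_mult:
  assumes "dim_col A = dim_row B"
  shows "(A * B)\<^sup>H = B\<^sup>H * A\<^sup>H"
  using assms by (intro eq_matI) (auto simp: scalar_prod_def mult.commute intro!: sum.cong)

lemma sesquilinear_form_sum:
  fixes A :: "complex mat"
  assumes "A \<in> carrier_mat n n" "v \<in> carrier_vec n"
  shows "(A *\<^sub>v v) \<bullet>c v = (\<Sum>i<n. (\<Sum>j<n. A $$ (i, j) * v $ j) * cnj (v $ i))"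
  using assms by (auto simp: scalar_prod_def atLeast0LessThan)

lemma sesquilinear_form_adjoint:
  fixes A :: "complex mat"
  assumes "A \<in> carrier_mat n m" "v \<in> carrier_vec m" "w \<in> carrier_vec n"
  shows "(A *\<^sub>v v) \<bullet>c w = v \<bullet>c (A\<^sup>H *\<^sub>v w)"
proof -
  have "(A *\<^sub>v v) \<bullet>c w = (\<Sum>i<n. \<Sum>j<m. A $$ (i, j) * v $ j * cnj (w $ i))"
    using assms by (auto simp: scalar_prod_def atLeast0LessThan sum_distrib_right)
  also have "\<dots> = (\<Sum>j<m. \<Sum>i<n. A $$ (i, j) * v $ j * cnj (w $ i))"
    by (rule sum.swap)
  also have "\<dots> = v \<bullet>c (A\<^sup>H *\<^sub>v w)"
    using assms by (auto simp: scalar_prod_def atLeast0LessThan sum_distrib_left ac_simps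
        intro!: sum.cong)
  finally show ?thesis .
qed

section \<open>Positive definite matrices and Hadamard's inequality\<close>

text \<open>Vectors are functions on \<open>nat\<close> and the form is an explicit sum, so that
  passing to the Schur complement amounts to splitting off index 0.\<close>

definition pd_mat :: "nat \<Rightarrow> complex mat \<Rightarrow> bool"
  where "pd_mat n A \<longleftrightarrow> A \<in> carrier_mat n n \<and> A\<^sup>H = A \<and>
    (\<forall>v. (\<exists>i<n. v i \<noteq> 0) \<longrightarrow> 0 < Re (\<Sum>i<n. (\<Sum>j<n. A $$ (i, j) * v j) * cnj (v i)))"

lemma pd_matD:
  assumes "pd_mat n A"
  shows "A \<in> carrier_mat n n"
    and "\<And>i j. i < n \<Longrightarrow> j < n \<Longrightarrow> cnj (A $$ (j, i)) = A $$ (i, j)"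
    and "\<And>i v. i < n \<Longrightarrow> v i \<noteq> 0 \<Longrightarrow>
      0 < Re (\<Sum>i<n. (\<Sum>j<n. A $$ (i, j) * v j) * cnj (v i))"
proof -
  show A: "A \<in> carrier_mat n n" using assms by (simp add: pd_mat_def)
  show "cnj (A $$ (j, i)) = A $$ (i, j)" if "i < n" "j < n" for i j
    using assms that A index_adjoint[of i A j] by (simp add: pd_mat_def del: index_adjoint)
  show "0 < Re (\<Sum>i<n. (\<Sum>j<n. A $$ (i, j) * v j) * cnj (v i))"
    if "i < n" "v i \<noteq> 0" for i v
    using assms that unfolding pd_mat_def by blast
qed

lemma pd_mat_diag_pos:
  assumes "pd_mat n A" "k < n"
  shows "0 < Re (A $$ (k, k))" "A $$ (k, k) = of_real (Re (A $$ (k, k)))"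
proof -
  have "(\<Sum>i<n. (\<Sum>j<n. A $$ (i, j) * (if j = k then 1 else 0)) * cnj (if i = k then 1 else 0))
      = (\<Sum>i<n. if i = k then A $$ (i, k) else 0)"
    using assms(2) by (intro sum.cong) (auto simp: if_distrib cong: if_cong)
  also have "\<dots> = A $$ (k, k)" using assms(2) by simp
  finally show "0 < Re (A $$ (k, k))"
    using pd_matD(3)[OF assms, of "\<lambda>i. if i = k then 1 else 0"] by simp
  show "A $$ (k, k) = of_real (Re (A $$ (k, k)))"
    using pd_matD(2)[OF assms(1) assms(2) assms(2)] by (simp add: complex_eq_iff)
qed

definition schur_compl :: "nat \<Rightarrow> complex mat \<Rightarrow> complex mat"
  where "schur_compl n A = mat n n (\<lambda>(i, j).
    A $$ (Suc i, Suc j) - A $$ (Suc i, 0) * A $$ (0, Suc j) / A $$ (0, 0))"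

text \<open>One step of Gaussian elimination: \<open>A = L * F\<close>, where the unit lower
  triangular \<open>L\<close> holds the multipliers of the first column and \<open>F\<close> is
  block upper triangular.\<close>

lemma det_schur_compl:
  assumes A: "A \<in> carrier_mat (Suc n) (Suc n)" and a: "A $$ (0, 0) \<noteq> 0"
  shows "det A = A $$ (0, 0) * det (schur_compl n A)"
proof -
  let ?a = "A $$ (0, 0)"
  define L where "L = four_block_mat (1\<^sub>m 1) (0\<^sub>m 1 n)
    (mat n 1 (\<lambda>(i, j). A $$ (Suc i, 0) / ?a)) (1\<^sub>m n)"
  define F where "F = four_block_mat (mat 1 1 (\<lambda>_. ?a)) (mat 1 n (\<lambda>(i, j). A $$ (0, Suc j)))
    (0\<^sub>m n 1) (schur_compl n A)"
  have c: "L \<in> carrier_mat (Suc n) (Suc n)" "F \<in> carrier_mat (Suc n) (Suc n)"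
    unfolding L_def F_def schur_compl_def carrier_mat_def by simp_all
  have "L * F = four_block_mat (mat 1 1 (\<lambda>_. ?a)) (mat 1 n (\<lambda>(i, j). A $$ (0, Suc j)))
      (mat n 1 (\<lambda>(i, j). A $$ (Suc i, 0)))
      (mat n n (\<lambda>(i, j). A $$ (Suc i, Suc j)))"
    unfolding L_def F_def
    by (subst mult_four_block_mat[where ?nr1.0 = 1 and ?n1.0 = 1 and ?n2.0 = n
          and ?nr2.0 = n and ?nc1.0 = 1 and ?nc2.0 = n])
      (use a in \<open>auto simp: schur_compl_def scalar_prod_def intro!: cong_four_block_mat eq_matI\<close>)
  also have "\<dots> = A"
    using A by (intro eq_matI) auto
  finally have "A = L * F" by simp
  moreover have "det L = 1"
    unfolding L_def by (subst det_four_block_mat_upper_right_zero[where n = 1 and m = n]) auto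
  moreover have "det F = ?a * det (schur_compl n A)"
    unfolding F_def by (subst det_four_block_mat_lower_left_zero[where n = 1 and m = n])
      (auto simp: schur_compl_def det_single)
  ultimately show ?thesis using det_mult[OF c] by simp
qed

text \<open>The form of the Schur complement at \<open>v\<close> is the form of \<open>A\<close> at
  \<open>v\<close> extended by a suitable first entry. On the diagonal, Hermitian symmetry makes the
  subtracted term a squared modulus over a positive pivot.\<close>

lemma pd_mat_schur_compl:
  assumes A: "pd_mat (Suc n) A"
  shows "pd_mat n (schur_compl n A)"
    and "\<And>i. i < n \<Longrightarrow> Re (schur_compl n A $$ (i, i)) \<le> Re (A $$ (Suc i, Suc i))"
proof -
  let ?a = "A $$ (0, 0)"
  let ?S = "schur_compl n A"
  note herm = pd_matD(2)[OF A]
  have a: "0 < Re ?a" "?a = of_real (Re ?a)" using pd_mat_diag_pos[OF A, of 0] by auto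
  then have a0: "?a \<noteq> 0" by auto
  show "pd_mat n ?S"
    unfolding pd_mat_def
  proof (intro conjI allI impI)
    show "?S \<in> carrier_mat n n" by (simp add: schur_compl_def)
    show "?S\<^sup>H = ?S"
      by (rule eq_matI) (simp_all add: schur_compl_def herm mult.commute)
    fix v :: "nat \<Rightarrow> complex" assume "\<exists>i<n. v i \<noteq> 0"
    then obtain i where i: "i < n" "v i \<noteq> 0" by blast
    \<comment> \<open>the first entry of \<open>w\<close> is chosen such that \<open>A w\<close> has first entry zero\<close>
    define w where "w = case_nat (- (\<Sum>j<n. A $$ (0, Suc j) * v j) / ?a) v"
    have row0: "(\<Sum>j<Suc n. A $$ (0, j) * w j) = 0"
      using a0 by (simp only: sum.lessThan_Suc_shift) (simp add: w_def)
    have row: "(\<Sum>j<Suc n. A $$ (Suc i, j) * w j) = (\<Sum>j<n. ?S $$ (i, j) * v j)"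
      if "i < n" for i
      using that by (simp only: sum.lessThan_Suc_shift)
        (simp add: w_def schur_compl_def algebra_simps sum_subtractf sum_distrib_left sum_divide_distrib)
    have "(\<Sum>i<Suc n. (\<Sum>j<Suc n. A $$ (i, j) * w j) * cnj (w i))
        = (\<Sum>i<n. (\<Sum>j<Suc n. A $$ (Suc i, j) * w j) * cnj (w (Suc i)))"
      by (subst sum.lessThan_Suc_shift, subst row0) simp
    also have "\<dots> = (\<Sum>i<n. (\<Sum>j<n. ?S $$ (i, j) * v j) * cnj (v i))"
      by (intro sum.cong refl, subst row) (simp_all add: w_def)
    finally show "0 < Re (\<Sum>i<n. (\<Sum>j<n. ?S $$ (i, j) * v j) * cnj (v i))"
      using pd_matD(3)[OF A, of "Suc i" w] i by (simp add: w_def)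
  qed
  show "Re (?S $$ (i, i)) \<le> Re (A $$ (Suc i, Suc i))" if "i < n" for i
  proof -
    have "A $$ (Suc i, 0) * A $$ (0, Suc i) = of_real ((cmod (A $$ (Suc i, 0)))\<^sup>2)"
      using that herm[of 0 "Suc i"] by (simp add: complex_norm_square del: of_real_power)
    then have "A $$ (Suc i, 0) * A $$ (0, Suc i) / ?a
        = of_real ((cmod (A $$ (Suc i, 0)))\<^sup>2 / Re ?a)"
      by (subst a(2)) simp
    then show ?thesis using that a(1) by (simp add: schur_compl_def)
  qed
qed

text \<open>Induction on the size: the determinant splits off the pivot, and the other factor is the
  determinant of the Schur complement, whose diagonal is dominated by that of \<open>A\<close>.
  Positivity is carried along because the logarithm of this determinant is taken later.\<close>

lemma hadamard_inequality:
  assumes "pd_mat n A"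
  shows "0 < Re (det A) \<and> Im (det A) = 0 \<and> Re (det A) \<le> (\<Prod>i<n. Re (A $$ (i, i)))"
  using assms
proof (induction n arbitrary: A)
  case 0
  then show ?case using pd_matD(1)[OF 0] by simp
next
  case (Suc n)
  let ?S = "schur_compl n A" and ?a = "Re (A $$ (0, 0))"
  have a: "0 < ?a" "A $$ (0, 0) = of_real ?a" using pd_mat_diag_pos[OF Suc.prems, of 0] by auto
  have det: "det A = of_real ?a * det ?S"
    using det_schur_compl[OF pd_matD(1)[OF Suc.prems]] a by force
  note IH = Suc.IH[OF pd_mat_schur_compl(1)[OF Suc.prems]]
  \<comment> \<open>The factors on the left are nonnegative since the Schur complement is itself
    positive definite.\<close>
  have "(\<Prod>i<n. Re (?S $$ (i, i))) \<le> (\<Prod>i<n. Re (A $$ (Suc i, Suc i)))"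
    using pd_mat_schur_compl[OF Suc.prems] pd_mat_diag_pos(1)
    by (intro prod_mono) (auto intro: less_imp_le)
  with IH have "Re (det ?S) \<le> (\<Prod>i<n. Re (A $$ (Suc i, Suc i)))" by linarith
  then have "?a * Re (det ?S) \<le> (\<Prod>i<Suc n. Re (A $$ (i, i)))"
    using a(1) by (subst prod.lessThan_Suc_shift) simp
  moreover have "Re (det A) = ?a * Re (det ?S)" "Im (det A) = ?a * Im (det ?S)"
    by (simp_all only: det Re_complex_of_real Im_complex_of_real times_complex.sel)
  ultimately show ?case using IH a(1) by simp
qed

section \<open>Semidefinite matrices: congruence, diagonal and trace\<close>

lemma mult_assoc_dim:
  fixes A B C :: "complex mat"
  assumes "dim_col A = dim_row B" "dim_col B = dim_row C"
  shows "A * B * C = A * (B * C)"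
  using assms by (intro assoc_mult_mat) (auto intro: carrier_matI)

text \<open>The form at \<open>v\<close> is the form of \<open>P\<close> at
  \<open>X\<^sup>H *\<^sub>v v\<close>.\<close>

lemma psd_mat_congruence:
  assumes P: "psd_mat m P" and X: "X \<in> carrier_mat n m"
  shows "psd_mat n (X * P * X\<^sup>H)"
proof -
  have Pc: "P \<in> carrier_mat m m" and Ph: "P\<^sup>H = P" using P by (simp_all add: psd_mat_def)
  note dims = carrier_matD[OF Pc] carrier_matD[OF X]
  have "(X * P * X\<^sup>H *\<^sub>v v) \<bullet>c v = (P *\<^sub>v (X\<^sup>H *\<^sub>v v)) \<bullet>c (X\<^sup>H *\<^sub>v v)"
    if v: "v \<in> carrier_vec n" for v
  proof -
    have Xv: "X\<^sup>H *\<^sub>v v \<in> carrier_vec m" using mult_mat_vec_carrier[OF adjoint_carrier[OF X] v] .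
    have "X * P * X\<^sup>H *\<^sub>v v = X *\<^sub>v (P *\<^sub>v (X\<^sup>H *\<^sub>v v))"
      using assoc_mult_mat_vec[OF mult_carrier_mat[OF X Pc] adjoint_carrier[OF X] v]
        assoc_mult_mat_vec[OF X Pc Xv] by simp
    then show ?thesis
      using sesquilinear_form_adjoint[OF X mult_mat_vec_carrier[OF Pc Xv] v] by simp
  qed
  moreover have "0 \<le> Re ((P *\<^sub>v (X\<^sup>H *\<^sub>v v)) \<bullet>c (X\<^sup>H *\<^sub>v v))" if "v \<in> carrier_vec n" for v
    using P mult_mat_vec_carrier[OF adjoint_carrier[OF X] that] by (simp add: psd_mat_def)
  moreover have "X * P * X\<^sup>H \<in> carrier_mat n n"
    by (rule carrier_matI) (simp_all add: dims)
  moreover have "(X * P * X\<^sup>H)\<^sup>H = X * P * X\<^sup>H"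
    by (simp add: adjoint_mult mult_assoc_dim Ph dims)
  ultimately show ?thesis by (simp add: psd_mat_def)
qed

lemma psd_mat_diag:
  assumes P: "psd_mat n P" and k: "k < n"
  shows "0 \<le> Re (P $$ (k, k))" "P $$ (k, k) = of_real (Re (P $$ (k, k)))"
proof -
  have Pc: "P \<in> carrier_mat n n" and Ph: "P\<^sup>H = P" using P by (simp_all add: psd_mat_def)
  have "(P *\<^sub>v unit_vec n k) \<bullet>c unit_vec n k = (\<Sum>i<n. if i = k then P $$ (i, k) else 0)"
    unfolding sesquilinear_form_sum[OF Pc unit_vec_carrier]
    using k by (intro sum.cong) (auto simp: if_distrib cong: if_cong)
  also have "\<dots> = P $$ (k, k)" using k by simp
  finally show "0 \<le> Re (P $$ (k, k))"
    using P unit_vec_carrier[of n k] by (metis psd_mat_def)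
  have "cnj (P $$ (k, k)) = P $$ (k, k)"
    using index_adjoint[of k P k] k carrier_matD[OF Pc] Ph by simp
  then show "P $$ (k, k) = of_real (Re (P $$ (k, k)))" by (simp add: complex_eq_iff)
qed

text \<open>The identity adds the squared norm of \<open>v\<close>, positive unless \<open>v\<close>
  vanishes, to a nonnegative form.\<close>

lemma pd_mat_one_plus_psd:
  assumes P: "psd_mat n P"
  shows "pd_mat n (1\<^sub>m n + P)"
  unfolding pd_mat_def
proof (intro conjI allI impI)
  have Pc: "P \<in> carrier_mat n n" and Ph: "P\<^sup>H = P" using P by (simp_all add: psd_mat_def)
  note dims = carrier_matD[OF Pc]
  show "1\<^sub>m n + P \<in> carrier_mat n n" using Pc by simp
  have herm: "cnj (P $$ (j, i)) = P $$ (i, j)" if "i < n" "j < n" for i j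
    using index_adjoint[of i P j] that dims Ph by simp
  show "(1\<^sub>m n + P)\<^sup>H = 1\<^sub>m n + P"
    by (rule eq_matI) (auto simp: dims herm)
  fix v :: "nat \<Rightarrow> complex" assume "\<exists>i<n. v i \<noteq> 0"
  then obtain k where k: "k < n" "v k \<noteq> 0" by blast
  have "(\<Sum>i<n. (\<Sum>j<n. (1\<^sub>m n + P) $$ (i, j) * v j) * cnj (v i))
      = (\<Sum>i<n. v i * cnj (v i) + (\<Sum>j<n. P $$ (i, j) * v j) * cnj (v i))"
  proof (rule sum.cong[OF refl])
    fix i assume "i \<in> {..<n}"
    then have "(\<Sum>j<n. (1\<^sub>m n + P) $$ (i, j) * v j)
        = (\<Sum>j<n. (if i = j then v j else 0) + P $$ (i, j) * v j)"
      by (intro sum.cong) (auto simp: dims algebra_simps)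
    also have "\<dots> = v i + (\<Sum>j<n. P $$ (i, j) * v j)"
      using \<open>i \<in> {..<n}\<close> by (simp add: sum.distrib)
    finally show "(\<Sum>j<n. (1\<^sub>m n + P) $$ (i, j) * v j) * cnj (v i)
        = v i * cnj (v i) + (\<Sum>j<n. P $$ (i, j) * v j) * cnj (v i)"
      by (simp add: algebra_simps)
  qed
  also have "\<dots> = of_real (\<Sum>i<n. (cmod (v i))\<^sup>2) + (P *\<^sub>v vec n v) \<bullet>c vec n v"
    using sesquilinear_form_sum[OF Pc, of "vec n v"]
    by (simp add: sum.distrib complex_norm_square del: of_real_power)
  finally have "Re (\<Sum>i<n. (\<Sum>j<n. (1\<^sub>m n + P) $$ (i, j) * v j) * cnj (v i))
      = (\<Sum>i<n. (cmod (v i))\<^sup>2) + Re ((P *\<^sub>v vec n v) \<bullet>c vec n v)" by simp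
  moreover have "0 < (\<Sum>i<n. (cmod (v i))\<^sup>2)"
    using k by (intro sum_pos2[of _ k]) auto
  moreover have "0 \<le> Re ((P *\<^sub>v vec n v) \<bullet>c vec n v)"
    using P by (simp add: psd_mat_def)
  ultimately show "0 < Re (\<Sum>i<n. (\<Sum>j<n. (1\<^sub>m n + P) $$ (i, j) * v j) * cnj (v i))" by linarith
qed

lemma mat_trace_mult_commute:
  assumes "A \<in> carrier_mat n m" "B \<in> carrier_mat m n"
  shows "mat_trace (A * B) = mat_trace (B * A)"
proof -
  note dims = carrier_matD[OF assms(1)] carrier_matD[OF assms(2)]
  have "mat_trace (A * B) = (\<Sum>i<n. \<Sum>j<m. A $$ (i, j) * B $$ (j, i))"
    by (simp add: mat_trace_def scalar_prod_def atLeast0LessThan dims)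
  also have "\<dots> = (\<Sum>j<m. \<Sum>i<n. A $$ (i, j) * B $$ (j, i))"
    by (rule sum.swap)
  also have "\<dots> = mat_trace (B * A)"
    by (simp add: mat_trace_def scalar_prod_def atLeast0LessThan dims mult.commute)
  finally show ?thesis .
qed

text \<open>Cyclicity of the trace. Rectangular \<open>X\<close> is allowed, so that the rule serves
  the precoder as well as the unitary change of basis.\<close>

lemma mat_trace_isometry:
  assumes X: "X \<in> carrier_mat n m" "X\<^sup>H * X = 1\<^sub>m m" and P: "P \<in> carrier_mat m m"
  shows "mat_trace (X * P * X\<^sup>H) = mat_trace P"
proof -
  have "mat_trace (X * P * X\<^sup>H) = mat_trace (X * (P * X\<^sup>H))"
    using X P by (subst mult_assoc_dim) auto
  also have "\<dots> = mat_trace (P * X\<^sup>H * X)"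
    using X P by (intro mat_trace_mult_commute) auto
  also have "P * X\<^sup>H * X = P"
    using X P by (subst mult_assoc_dim) auto
  finally show ?thesis .
qed

section \<open>Diagonal matrices, square and rectangular, and unitary conjugation\<close>

lemma real_diag_simps [simp]:
  "real_diag L p \<in> carrier_mat L L" "dim_row (real_diag L p) = L" "dim_col (real_diag L p) = L"
  "i < L \<Longrightarrow> j < L \<Longrightarrow> real_diag L p $$ (i, j) = (if i = j then of_real (p j) else 0)"
  by (simp_all add: real_diag_def mat_diag_def)

lemma psd_mat_real_diag:
  assumes "\<And>n. n < L \<Longrightarrow> 0 \<le> p n"
  shows "psd_mat L (real_diag L p)"
  unfolding psd_mat_def
proof (intro conjI ballI)
  show "(real_diag L p)\<^sup>H = real_diag L p"
    by (rule eq_matI) auto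
  fix v :: "complex vec" assume v: "v \<in> carrier_vec L"
  have "(real_diag L p *\<^sub>v v) \<bullet>c v = (\<Sum>i<L. of_real (p i) * (v $ i * cnj (v $ i)))"
    unfolding sesquilinear_form_sum[OF real_diag_simps(1) v]
  proof (intro sum.cong refl)
    fix i assume i: "i \<in> {..<L}"
    then have "(\<Sum>j<L. real_diag L p $$ (i, j) * v $ j) = (\<Sum>j<L. if i = j then of_real (p j) * v $ j else 0)"
      by (intro sum.cong) auto
    then show "(\<Sum>j<L. real_diag L p $$ (i, j) * v $ j) * cnj (v $ i)
        = of_real (p i) * (v $ i * cnj (v $ i))" using i by simp
  qed
  also have "\<dots> = of_real (\<Sum>i<L. p i * (cmod (v $ i))\<^sup>2)"
    by (simp add: complex_norm_square del: of_real_power)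
  finally show "0 \<le> Re ((real_diag L p *\<^sub>v v) \<bullet>c v)"
    using assms by (auto intro!: sum_nonneg)
qed simp

text \<open>The only entry of column \<open>n\<close> of \<open>S\<close> that can be nonzero lies
  in row \<open>n\<close>, and this row exists only for \<open>n < N\<close>.\<close>

lemma gram_diag_diagonal:
  assumes S: "S \<in> carrier_mat N L" "diagonal_mat S" and n: "n < L"
  shows "gram_diag S n = (if n < N then (cmod (S $$ (n, n)))\<^sup>2 else 0)"
proof -
  note dims = carrier_matD[OF S(1)]
  have "(S\<^sup>H * S) $$ (n, n) = (\<Sum>i<N. cnj (S $$ (i, n)) * S $$ (i, n))"
    using n by (simp add: scalar_prod_def atLeast0LessThan dims)
  also have "\<dots> = (\<Sum>i<N. if i = n then of_real ((cmod (S $$ (n, n)))\<^sup>2) else 0)"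
    using S(2) n by (intro sum.cong)
      (auto simp: diagonal_mat_def dims complex_norm_square mult.commute simp del: of_real_power)
  finally show ?thesis by (simp add: gram_diag_def)
qed

text \<open>The two products rescale the rows and columns of \<open>P\<close>. If \<open>i\<close>
  or \<open>j\<close> is at least \<open>L\<close>, the corresponding row of \<open>S\<close> is
  zero.\<close>

lemma diagonal_congruence_index:
  assumes S: "S \<in> carrier_mat N L" "diagonal_mat S" and P: "P \<in> carrier_mat L L"
    and i: "i < N" and j: "j < N"
  shows "(S * P * S\<^sup>H) $$ (i, j)
    = (if i < L \<and> j < L then S $$ (i, i) * P $$ (i, j) * cnj (S $$ (j, j)) else 0)"
proof -
  note dims = carrier_matD[OF S(1)] carrier_matD[OF P]
  have S0: "S $$ (i, j) = 0" if "i < N" "j < L" "i \<noteq> j" for i j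
    using S(2) that by (simp add: diagonal_mat_def dims)
  have SP: "(S * P) $$ (i, k) = (if i < L then S $$ (i, i) * P $$ (i, k) else 0)" if "k < L" for k
  proof -
    have "(S * P) $$ (i, k) = (\<Sum>m<L. S $$ (i, m) * P $$ (m, k))"
      using i that by (simp add: scalar_prod_def atLeast0LessThan dims)
    also have "\<dots> = (\<Sum>m<L. if m = i then S $$ (i, i) * P $$ (i, k) else 0)"
      using i S0 by (intro sum.cong) auto
    finally show ?thesis by simp
  qed
  have "(S * P * S\<^sup>H) $$ (i, j) = (\<Sum>k<L. (S * P) $$ (i, k) * cnj (S $$ (j, k)))"
    using i j by (simp add: scalar_prod_def[of "row (S * P) i"] atLeast0LessThan dims)
  also have "\<dots> = (\<Sum>k<L. if k = j then (S * P) $$ (i, j) * cnj (S $$ (j, j)) else 0)"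
    using j S0 by (intro sum.cong) auto
  finally show ?thesis using SP by simp
qed

text \<open>The identity is \<open>U * U\<^sup>H\<close>, so \<open>U\<close> factors out on both
  sides, and the determinants of \<open>U\<close> and \<open>U\<^sup>H\<close> cancel.\<close>

lemma det_one_plus_unitary_conj:
  assumes U: "unitary_mat n U" and X: "X \<in> carrier_mat n n"
  shows "det (1\<^sub>m n + U * X * U\<^sup>H) = det (1\<^sub>m n + X)"
proof -
  have Uc: "U \<in> carrier_mat n n" "U\<^sup>H \<in> carrier_mat n n" and UU: "U * U\<^sup>H = 1\<^sub>m n"
    using U by (auto simp: unitary_mat_def)
  have "U * (1\<^sub>m n + X) * U\<^sup>H = (U + U * X) * U\<^sup>H"
    using mult_add_distrib_mat[OF Uc(1) one_carrier_mat X] Uc by simp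
  also have "\<dots> = 1\<^sub>m n + U * X * U\<^sup>H"
    using add_mult_distrib_mat[OF Uc(1) mult_carrier_mat[OF Uc(1) X] Uc(2)] UU by simp
  finally have "det (1\<^sub>m n + U * X * U\<^sup>H) = det U * det (1\<^sub>m n + X) * det (U\<^sup>H)"
    using det_mult[of U n "1\<^sub>m n + X"] det_mult[of "U * (1\<^sub>m n + X)" n "U\<^sup>H"] Uc X
    by (metis add_carrier_mat mult_carrier_mat)
  moreover have "det U * det (U\<^sup>H) = 1"
    using det_mult[OF Uc] UU by simp
  ultimately show ?thesis by (simp add: mult.commute mult.left_commute)
qed

section \<open>Scalar water-filling\<close>

lemma water_power_nonneg: "0 \<le> water_power \<beta> c l"
  by (simp add: water_power_def)

lemma water_power_mono:
  "\<beta> \<le> \<beta>' \<Longrightarrow> water_power \<beta> c l \<le> water_power \<beta>' c l"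
  by (auto simp: water_power_def)

text \<open>A channel without power at level \<open>\<beta>\<close> may stay without power at a
  higher level, hence the positivity assumption.\<close>

lemma water_power_strict_mono:
  "\<beta> < \<beta>' \<Longrightarrow> 0 < water_power \<beta> c l \<Longrightarrow> water_power \<beta> c l < water_power \<beta>' c l"
  by (auto simp: water_power_def split: if_splits)

lemma water_power_nonpos_level:
  "\<beta> \<le> 0 \<Longrightarrow> 0 \<le> c \<Longrightarrow> 0 \<le> l \<Longrightarrow> water_power \<beta> c l = 0"
  by (auto simp: water_power_def intro!: max_absorb1 order_trans[OF _ divide_nonneg_nonneg])

lemma continuous_on_water_power: "continuous_on A (\<lambda>\<beta>. water_power \<beta> c l)"
proof (cases "l = 0")
  case False
  then have "(\<lambda>\<beta>. water_power \<beta> c l) = (\<lambda>\<beta>. max 0 (\<beta> - c / l))"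
    by (simp add: water_power_def)
  then show ?thesis by (simp only:) (intro continuous_on_max continuous_intros)
qed (simp add: water_power_def)

text \<open>Concavity of \<open>ln\<close>: its tangent at \<open>b\<close> lies above the
  graph.\<close>

lemma ln_ratio_le:
  fixes a b :: real
  assumes "0 < a" "0 < b"
  shows "ln a \<le> ln b + (a - b) / b"
  using ln_le_minus_one[of "a / b"] assms by (simp add: ln_div diff_divide_distrib)

text \<open>The derivative \<open>l / (1 + l * p)\<close> of the rate at the water power is \<open>1 / \<beta>\<close> if that power is
  positive, and at most \<open>1 / \<beta>\<close> otherwise.\<close>

lemma water_power_rate_le:
  assumes l: "0 \<le> l" and \<beta>: "0 < \<beta>" and p: "0 \<le> p"
  shows "ln (1 + l * p) \<le> ln (1 + l * water_power \<beta> 1 l) + (p - water_power \<beta> 1 l) / \<beta>"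
proof (cases "l = 0")
  case True
  then show ?thesis using \<beta> p by (simp add: water_power_def)
next
  case False
  define w where "w = water_power \<beta> 1 l"
  have l: "0 < l" using l False by simp
  have w: "w = max 0 (\<beta> - 1 / l)" using False by (simp add: w_def water_power_def)
  have pos: "0 < 1 + l * p" "0 < 1 + l * w" using l p w by (auto intro!: add_pos_nonneg)
  have "ln (1 + l * p) \<le> ln (1 + l * w) + (1 + l * p - (1 + l * w)) / (1 + l * w)"
    using ln_ratio_le[OF pos] .
  moreover have "(1 + l * p - (1 + l * w)) / (1 + l * w) \<le> (p - w) / \<beta>"
  proof (cases "1 / l \<le> \<beta>")
    case True
    then have "w = \<beta> - 1 / l" using w by simp
    then have "1 + l * w = l * \<beta>" using l by (simp add: right_diff_distrib)
    moreover have "1 + l * p - (1 + l * w) = l * (p - w)" by (simp add: algebra_simps)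
    ultimately show ?thesis using l by simp
  next
    case False
    then have "w = 0" "l * \<beta> \<le> 1" using w l by (auto simp: field_simps)
    then show ?thesis using \<beta> p mult_right_mono[of "l * \<beta>" 1 p] by (simp add: field_simps)
  qed
  ultimately show ?thesis unfolding w_def by linarith
qed

lemma is_arg_max_linorder_iff:
  fixes f :: "'a \<Rightarrow> 'b::linorder"
  shows "is_arg_max f P x \<longleftrightarrow> P x \<and> (\<forall>y. P y \<longrightarrow> f y \<le> f x)"
  by (auto simp: is_arg_max_def not_less)

text \<open>The number \<open>1 / \<beta>\<close> acts as the Lagrange multiplier: it is the same
  slope for all channels, so the linear terms add up to the difference of total powers over
  \<open>\<beta>\<close>, which is nonpositive for a feasible competitor.\<close>

lemma water_filling_optimal:
  assumes l: "\<And>n. n < L \<Longrightarrow> 0 \<le> l n" and B: "0 < B"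
    and sat: "(\<Sum>n<L. water_power \<beta> 1 (l n)) = B"
  shows "is_arg_max (sum_rate L l) (feasible_powers L B) (\<lambda>n. water_power \<beta> 1 (l n))"
proof -
  let ?w = "\<lambda>n. water_power \<beta> 1 (l n)"
  \<comment> \<open>At a level that is not positive all powers would vanish, contradicting
    saturation of \<open>B > 0\<close>.\<close>
  have \<beta>: "0 < \<beta>"
  proof (rule ccontr)
    assume "\<not> 0 < \<beta>"
    then have "?w n = 0" if "n < L" for n
      using l[OF that] by (simp add: water_power_nonpos_level)
    then show False using sat B by simp
  qed
  have "sum_rate L l q \<le> sum_rate L l ?w" if q: "feasible_powers L B q" for q
  proof -
    have "(\<Sum>n<L. ln (1 + l n * q n)) \<le> (\<Sum>n<L. ln (1 + l n * ?w n) + (q n - ?w n) / \<beta>)"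
      using q l \<beta> by (intro sum_mono water_power_rate_le) (auto simp: feasible_powers_def)
    also have "\<dots> = (\<Sum>n<L. ln (1 + l n * ?w n)) + ((\<Sum>n<L. q n) - B) / \<beta>"
      by (simp add: sum.distrib sum_divide_distrib[symmetric] sum_subtractf sat)
    also have "\<dots> \<le> (\<Sum>n<L. ln (1 + l n * ?w n))"
      using q \<beta> by (simp add: feasible_powers_def divide_nonpos_pos)
    finally show ?thesis
      by (simp add: sum_rate_def log_def sum_divide_distrib[symmetric] divide_right_mono)
  qed
  moreover have "feasible_powers L B ?w"
    using sat by (simp add: feasible_powers_def water_power_nonneg)
  ultimately show ?thesis by (simp add: is_arg_max_linorder_iff)
qed

lemma water_level_ex1:
  fixes L :: nat and l :: "nat \<Rightarrow> real"
  assumes l: "\<And>n. n < L \<Longrightarrow> 0 \<le> l n" and k: "k < L" "l k \<noteq> 0" and B: "0 < B"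
  shows "\<exists>!\<beta>. (\<Sum>n<L. water_power \<beta> 1 (l n)) = B"
proof -
  let ?f = "\<lambda>\<beta>. \<Sum>n<L. water_power \<beta> 1 (l n)"
  have lk: "0 < l k" using l[OF k(1)] k(2) by simp
  have "?f 0 \<le> B"
    using B l by (simp add: water_power_nonpos_level)
  \<comment> \<open>At this level channel \<open>k\<close> alone already receives power
    \<open>B\<close>.\<close>
  moreover have "B \<le> ?f (B + 1 / l k)"
  proof -
    have "B \<le> water_power (B + 1 / l k) 1 (l k)" using k by (simp add: water_power_def)
    also have "\<dots> \<le> ?f (B + 1 / l k)"
      using k water_power_nonneg by (intro member_le_sum[of k]) simp_all
    finally show ?thesis .
  qed
  moreover have "continuous_on {0..B + 1 / l k} ?f"
    by (intro continuous_on_sum continuous_on_water_power)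
  ultimately obtain \<beta> where \<beta>: "?f \<beta> = B"
    using IVT'[of ?f 0 B "B + 1 / l k"] B lk by auto
  \<comment> \<open>This gives uniqueness. The total power is constantly zero on nonpositive levels,
    so strict growth is claimed only from a level with total \<open>B\<close>; there
    \<open>B > 0\<close> provides a channel with positive power.\<close>
  have mono: "?f x < ?f y" if xy: "x < y" "?f x = B" for x y
  proof -
    have "\<exists>n<L. 0 < water_power x 1 (l n)"
    proof (rule ccontr)
      assume "\<not> ?thesis"
      then have "?f x \<le> 0" by (intro sum_nonpos) (meson lessThan_iff not_less)
      then show False using xy(2) B by simp
    qed
    then have "\<exists>n\<in>{..<L}. water_power x 1 (l n) < water_power y 1 (l n)"
      using water_power_strict_mono[OF xy(1)] by blast
    then show ?thesis
      using xy(1) by (intro sum_strict_mono_ex1) (auto intro!: water_power_mono)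
  qed
  show ?thesis
  proof (rule ex1I[of _ \<beta>])
    fix \<beta>' assume "?f \<beta>' = B"
    then show "\<beta>' = \<beta>" using mono[of \<beta> \<beta>'] mono[of \<beta>' \<beta>] \<beta> by (cases \<beta> \<beta>' rule: linorder_cases) auto
  qed (rule \<beta>)
qed

section \<open>The link in the coordinates of its singular value decomposition\<close>

text \<open>The precoder \<open>V\<close> is any matrix with orthonormal columns, so that the
  results can be instantiated both with \<open>V2\<close> (where \<open>W\<close> is
  \<open>VK\<close>) and with \<open>V2 * VK\<close> (where \<open>W\<close> is the
  identity).\<close>

locale mimo_svd =
  fixes N M L :: nat and D H V U S W :: "complex mat" and B :: real
  assumes D: "D \<in> carrier_mat N N" "D\<^sup>H = D"
    and H: "H \<in> carrier_mat N M"
    and V: "V \<in> carrier_mat M L" "V\<^sup>H * V = 1\<^sub>m L"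
    and svd: "is_svd N L (D * H * V) U S W"
begin

abbreviation "rate \<equiv> tx_rate N D H V"
abbreviation "feas \<equiv> feasible_cov L V B"
abbreviation "tilde P \<equiv> W\<^sup>H * P * W"
abbreviation "diag_powers P \<equiv> \<lambda>n. Re (tilde P $$ (n, n))"
abbreviation "of_powers p \<equiv> W * real_diag L p * W\<^sup>H"
abbreviation "gain \<equiv> gram_diag S"

lemma U: "unitary_mat N U" "U \<in> carrier_mat N N"
  and W: "W \<in> carrier_mat L L" "W\<^sup>H * W = 1\<^sub>m L" "W * W\<^sup>H = 1\<^sub>m L"
  and S: "S \<in> carrier_mat N L" "diagonal_mat S"
  and K: "D * H * V = U * S * W\<^sup>H"
  using svd by (auto simp: is_svd_def unitary_mat_def)

lemmas dims = carrier_matD[OF D(1)] carrier_matD[OF H] carrier_matD[OF V(1)]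
  carrier_matD[OF U(2)] carrier_matD[OF S(1)] carrier_matD[OF W(1)]

lemma tilde_of_powers: "tilde (of_powers p) = real_diag L p"
proof -
  have "tilde (of_powers p) = (W\<^sup>H * W) * real_diag L p * (W\<^sup>H * W)"
    by (simp add: mult_assoc_dim dims)
  then show ?thesis
    by (simp add: W(2) left_mult_one_mat[OF real_diag_simps(1)]
        right_mult_one_mat[OF real_diag_simps(1)])
qed

text \<open>As \<open>D\<close> is Hermitian, the term added to the identity is the congruence of
  \<open>P\<close> by \<open>D * H * V\<close>. After inserting the decomposition, the outer factor
  \<open>U\<close> drops out of the determinant.\<close>

lemma rate_eq:
  assumes P: "P \<in> carrier_mat L L"
  shows "rate P = log 2 (Re (det (1\<^sub>m N + S * tilde P * S\<^sup>H)))"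
proof -
  note P_dims = carrier_matD[OF P]
  have "D * H * V * P * V\<^sup>H * H\<^sup>H * D = (D * H * V) * P * (D * H * V)\<^sup>H"
    by (simp add: adjoint_mult mult_assoc_dim dims P_dims D(2))
  also have "\<dots> = U * (S * tilde P * S\<^sup>H) * U\<^sup>H"
    unfolding K by (simp add: adjoint_mult mult_assoc_dim dims P_dims)
  moreover have "S * tilde P * S\<^sup>H \<in> carrier_mat N N"
    by (rule carrier_matI) (simp_all add: dims)
  ultimately show ?thesis
    using det_one_plus_unitary_conj[OF U(1)] by (simp add: tx_rate_def)
qed

lemma gain_nonneg: "n < L \<Longrightarrow> 0 \<le> gain n"
  using gram_diag_diagonal[OF S] by simp

text \<open>A receive dimension with index at least \<open>L\<close> carries no signal, hence the
  entry 1.\<close>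

lemma index_received:
  assumes P: "P \<in> carrier_mat L L" and i: "i < N"
  shows "(1\<^sub>m N + S * P * S\<^sup>H) $$ (i, i) = (if i < L then 1 + gain i * P $$ (i, i) else 1)"
proof -
  have "S $$ (i, i) * P $$ (i, i) * cnj (S $$ (i, i)) = gain i * P $$ (i, i)" if "i < L"
    using gram_diag_diagonal[OF S that] i
    by (simp add: complex_norm_square mult.commute mult.left_commute del: of_real_power)
  then show ?thesis
    using i diagonal_congruence_index[OF S P i i] by (simp add: dims)
qed

text \<open>Hadamard's bound has one factor per receive dimension (\<open>N\<close>), the sum rate
  one term per stream (\<open>L\<close>). Both products reduce to the indices below \<open>N\<close>
  and \<open>L\<close>, since \<open>gain n\<close> is zero for
  \<open>N \<le> n < L\<close>.\<close>

lemma prod_received: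
  "(\<Prod>i<N. if i < L then 1 + gain i * p i else 1) = (\<Prod>n<L. 1 + gain n * p n)"
proof -
  have "(\<Prod>i<N. if i < L then 1 + gain i * p i else 1) = (\<Prod>i\<in>{..<N} \<inter> {..<L}. 1 + gain i * p i)"
    by (subst prod.inter_restrict) simp_all
  also have "\<dots> = (\<Prod>i<L. if i < N then 1 + gain i * p i else 1)"
    by (subst Int_commute, subst prod.inter_restrict) simp_all
  also have "\<dots> = (\<Prod>n<L. 1 + gain n * p n)"
    using gram_diag_diagonal[OF S] by (intro prod.cong) auto
  finally show ?thesis .
qed

lemma sum_rate_eq:
  assumes "\<And>n. n < L \<Longrightarrow> 0 \<le> p n"
  shows "sum_rate L gain p = log 2 (\<Prod>n<L. 1 + gain n * p n)"
proof -
  have "0 < 1 + gain n * p n" if "n < L" for n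
    using assms gain_nonneg that by (simp add: add_pos_nonneg)
  then have "ln (\<Prod>n<L. 1 + gain n * p n) = (\<Sum>n<L. ln (1 + gain n * p n))"
    by (intro ln_prod) (auto simp: less_imp_neq[symmetric])
  then show ?thesis
    by (simp add: sum_rate_def log_def sum_divide_distrib)
qed

lemma psd_tilde: "psd_mat L P \<Longrightarrow> psd_mat L (tilde P)"
  using psd_mat_congruence[OF _ adjoint_carrier[OF W(1)]] by simp

text \<open>Hadamard's inequality for the received matrix: only the diagonal of
  \<open>tilde P\<close> enters its right-hand side.\<close>

lemma rate_le_sum_rate:
  assumes P: "psd_mat L P"
  shows "rate P \<le> sum_rate L gain (diag_powers P)"
proof -
  let ?R = "1\<^sub>m N + S * tilde P * S\<^sup>H"
  have Pc: "P \<in> carrier_mat L L" "tilde P \<in> carrier_mat L L"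
    using P psd_tilde[OF P] by (auto simp: psd_mat_def)
  note hadamard = hadamard_inequality[OF pd_mat_one_plus_psd,
      OF psd_mat_congruence[OF psd_tilde[OF P] S(1)]]
  have "(\<Prod>i<N. Re (?R $$ (i, i))) = (\<Prod>i<N. if i < L then 1 + gain i * diag_powers P i else 1)"
    by (intro prod.cong refl, subst index_received[OF Pc(2)]) auto
  then have "Re (det ?R) \<le> (\<Prod>n<L. 1 + gain n * diag_powers P n)"
    using hadamard by (simp only: prod_received)
  then have "rate P \<le> log 2 (\<Prod>n<L. 1 + gain n * diag_powers P n)"
    using hadamard unfolding rate_eq[OF Pc(1)] by (intro log_mono) simp_all
  then show ?thesis
    using psd_mat_diag(1)[OF psd_tilde[OF P]] by (simp add: sum_rate_eq)
qed

lemma of_powers_carrier: "of_powers p \<in> carrier_mat L L"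
  by (rule carrier_matI) (simp_all add: dims)

text \<open>The equality case of Hadamard's inequality: the received matrix is diagonal.\<close>

lemma rate_of_powers:
  assumes p: "\<And>n. n < L \<Longrightarrow> 0 \<le> p n"
  shows "rate (of_powers p) = sum_rate L gain p"
proof -
  let ?R = "1\<^sub>m N + S * real_diag L p * S\<^sup>H"
  have R: "?R \<in> carrier_mat N N" by (rule carrier_matI) (simp_all add: dims)
  have "?R $$ (i, j) = 0" if "i < N" "j < N" "i \<noteq> j" for i j
    using that diagonal_congruence_index[OF S real_diag_simps(1) that(1,2), of p] by (simp add: dims)
  then have "det ?R = (\<Prod>i<N. ?R $$ (i, i))"
    using R by (subst det_lower_triangular[of N])
      (auto simp: prod_list_diag_prod atLeast0LessThan dims)
  also have "\<dots> = (\<Prod>i<N. of_real (if i < L then 1 + gain i * p i else 1))"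
    by (intro prod.cong refl, subst index_received) auto
  also have "\<dots> = of_real (\<Prod>n<L. 1 + gain n * p n)"
    by (simp only: of_real_prod[symmetric] prod_received)
  finally have "Re (det ?R) = (\<Prod>n<L. 1 + gain n * p n)"
    by (simp only: Re_complex_of_real)
  then show ?thesis
    using p by (simp add: rate_eq[OF of_powers_carrier] tilde_of_powers sum_rate_eq)
qed

text \<open>The precoder is an isometry and drops out of the power constraint.\<close>

lemma feas_iff: "feas P \<longleftrightarrow> psd_mat L P \<and> Re (mat_trace P) \<le> B"
  using mat_trace_isometry[OF V] by (auto simp: feasible_cov_def psd_mat_def)

lemma feasible_diag_powers:
  assumes "feas P"
  shows "feasible_powers L B (diag_powers P)"
proof -
  have P: "psd_mat L P" "P \<in> carrier_mat L L" "Re (mat_trace P) \<le> B"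
    using assms by (auto simp: feas_iff psd_mat_def)
  \<comment> \<open>Here the isometry is \<open>W\<^sup>H\<close>, whose adjoint is
    \<open>W\<close>, so the condition to meet is
    \<open>W * W\<^sup>H = 1\<^sub>m L\<close>.\<close>
  have "mat_trace (tilde P) = mat_trace P"
    using mat_trace_isometry[of "W\<^sup>H" L L P] W P(2) by simp
  moreover have "(\<Sum>n<L. diag_powers P n) = Re (mat_trace (tilde P))"
    by (simp add: mat_trace_def dims)
  ultimately have "(\<Sum>n<L. diag_powers P n) \<le> B"
    using P(3) by simp
  then show ?thesis
    using psd_mat_diag(1)[OF psd_tilde[OF P(1)]] by (simp add: feasible_powers_def)
qed

lemma feas_of_powers: "feas (of_powers p) \<longleftrightarrow> feasible_powers L B p"
proof
  assume "feas (of_powers p)"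
  \<comment> \<open>Taking \<open>diag_powers\<close> of \<open>of_powers p\<close> gives back
    \<open>p\<close> below \<open>L\<close>.\<close>
  from feasible_diag_powers[OF this] show "feasible_powers L B p"
    by (simp add: feasible_powers_def tilde_of_powers)
next
  assume p: "feasible_powers L B p"
  then have "psd_mat L (of_powers p)"
    by (intro psd_mat_congruence[OF _ W(1)] psd_mat_real_diag) (simp add: feasible_powers_def)
  moreover have "Re (mat_trace (of_powers p)) = (\<Sum>n<L. p n)"
    by (simp add: mat_trace_isometry[OF W(1,2)]) (simp add: mat_trace_def)
  ultimately show "feas (of_powers p)"
    using p by (simp add: feas_iff feasible_powers_def)
qed

text \<open>The Hadamard bound for \<open>P\<close> depends on the diagonal of
  \<open>tilde P\<close> only and is attained by the diagonal matrix with these entries.\<close>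

lemma rate_le_rate_diag:
  assumes "feas P"
  shows "rate P \<le> rate (of_powers (diag_powers P))"
proof -
  have "rate (of_powers (diag_powers P)) = sum_rate L gain (diag_powers P)"
    using feasible_diag_powers[OF assms] by (intro rate_of_powers) (simp add: feasible_powers_def)
  then show ?thesis using rate_le_sum_rate assms by (simp add: feas_iff)
qed

text \<open>The map \<open>of_powers\<close> embeds the scalar problem with equal objective, and
  \<open>diag_powers\<close> sends a feasible covariance to feasible powers whose sum rate is at
  least its rate.\<close>

lemma arg_max_of_powers:
  "is_arg_max rate feas (of_powers p) \<longleftrightarrow> is_arg_max (sum_rate L gain) (feasible_powers L B) p"
proof -
  have rate: "rate (of_powers q) = sum_rate L gain q" if "feasible_powers L B q" for q
    using that by (intro rate_of_powers) (simp add: feasible_powers_def)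
  show ?thesis
    unfolding is_arg_max_linorder_iff feas_of_powers
  proof (intro conj_cong refl iffI allI impI)
    fix q assume "feasible_powers L B p" "feasible_powers L B q"
      and "\<forall>P. feas P \<longrightarrow> rate P \<le> rate (of_powers p)"
    then show "sum_rate L gain q \<le> sum_rate L gain p"
      using rate feas_of_powers by metis
  next
    fix P assume p: "feasible_powers L B p" and P: "feas P"
      and max: "\<forall>q. feasible_powers L B q \<longrightarrow> sum_rate L gain q \<le> sum_rate L gain p"
    have "rate P \<le> sum_rate L gain (diag_powers P)"
      using rate_le_sum_rate P by (simp add: feas_iff)
    also have "\<dots> \<le> sum_rate L gain p" using max feasible_diag_powers[OF P] by blast
    finally show "rate P \<le> rate (of_powers p)" using rate[OF p] by simp
  qed
qed

text \<open>If all gains vanish then so does \<open>S\<close>. This supplies the channel that the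
  existence of a water level requires.\<close>

lemma gain_nonzero:
  assumes "D * H * V \<noteq> 0\<^sub>m N L"
  shows "\<exists>n<L. gain n \<noteq> 0"
proof (rule ccontr)
  assume "\<not> ?thesis"
  then have "S $$ (i, j) = 0" if "i < N" "j < L" for i j
    using that S(2) gram_diag_diagonal[OF S] by (cases "i = j") (auto simp: diagonal_mat_def dims)
  then have "S = 0\<^sub>m N L" by (intro eq_matI) (simp_all add: dims)
  then have "D * H * V = 0\<^sub>m N L"
    using U(2) W(1) by (simp add: K)
  with assms show False by simp
qed

lemma ex_arg_max:
  assumes B: "0 < B"
  shows "\<exists>p. is_arg_max (sum_rate L gain) (feasible_powers L B) p"
proof (cases "\<exists>n<L. gain n \<noteq> 0")
  case True
  then obtain \<beta> where "(\<Sum>n<L. water_power \<beta> 1 (gain n)) = B"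
    using water_level_ex1[of L gain _ B, OF gain_nonneg _ _ B] by blast
  then show ?thesis
    using water_filling_optimal[of L gain B \<beta>, OF gain_nonneg B] by blast
next
  \<comment> \<open>This case includes \<open>L = 0\<close>. The sum rate is constantly zero, so the
    zero allocation is optimal.\<close>
  case False
  then have "sum_rate L gain q = 0" for q by (simp add: sum_rate_def)
  then have "is_arg_max (sum_rate L gain) (feasible_powers L B) (\<lambda>_. 0)"
    using B by (simp add: is_arg_max_linorder_iff feasible_powers_def)
  then show ?thesis by blast
qed

end

section \<open>The secondary link with the precoders \<open>V2\<close> and
  \<open>V2 * VK\<close>\<close>

theorem mainTheorem5:
  fixes N1 N2 M1 M2 m1 L2 :: nat
    and H11 H12 H21 H22 U11 \<Lambda>11 V11 P1 Ht1 V2 Q D2 K UK \<Lambda>K VK :: "complex mat"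
    and \<sigma>1 \<sigma>2 p1max p2max \<beta> :: real
    and p1 l :: "nat \<Rightarrow> real"
  assumes dims: "0 < N1" "0 < N2" "0 < M1" "0 < M2"
    and channels: "H11 \<in> carrier_mat N1 M1" "H12 \<in> carrier_mat N1 M2"
      "H21 \<in> carrier_mat N2 M1" "H22 \<in> carrier_mat N2 M2"
    and params: "0 < \<sigma>1" "0 < \<sigma>2" "0 < p1max" "0 < p2max"
    and svd11: "is_svd N1 M1 H11 U11 \<Lambda>11 V11"
    and sorted11: "\<And>m n. m \<le> n \<Longrightarrow> n < M1 \<Longrightarrow> gram_diag \<Lambda>11 n \<le> gram_diag \<Lambda>11 m"
    and p1: "\<And>n. p1 n = water_power \<beta> (\<sigma>1\<^sup>2) (gram_diag \<Lambda>11 n)"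
    and \<beta>: "(\<Sum>n<M1. p1 n) = real M1 * p1max"
    and P1: "P1 = real_diag M1 p1"
    and m1: "m1 = card {n. n < M1 \<and> 0 < p1 n}"
    and Ht1: "Ht1 = mat m1 M2 (\<lambda>(i, j). (U11\<^sup>H * H12) $$ (i, j))"
    and L2: "L2 = kernel_dim Ht1"
    and V2: "orthonormal_kernel_basis M2 Ht1 V2"
    and Q: "Q = H21 * V11 * P1 * V11\<^sup>H * H21\<^sup>H + complex_of_real (\<sigma>2\<^sup>2) \<cdot>\<^sub>m 1\<^sub>m N2"
    and D2: "is_inv_sqrt N2 Q D2"
    and K: "K = D2 * H22 * V2"
    and svdK: "is_svd N2 L2 K UK \<Lambda>K VK"
    and l: "\<And>n. l n = gram_diag \<Lambda>K n"
  shows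
    "let B = real M2 * p2max;
         rate = tx_rate N2 D2 H22 V2;
         feas = feasible_cov L2 V2 B;
         tilde = (\<lambda>P. VK\<^sup>H * P * VK);
         diag_powers = (\<lambda>P n. Re (tilde P $$ (n, n)));
         of_powers = (\<lambda>p. VK * real_diag L2 p * VK\<^sup>H);
         water = (\<lambda>\<beta>2 n. water_power \<beta>2 1 (l n));
         V2_OPA = V2 * VK;
         P2_OPA = (\<lambda>\<beta>2. real_diag L2 (water \<beta>2))
     in
       (\<comment> \<open>a diagonal \<open>tilde P\<close> is optimal; discarding the off-diagonal entries of
           \<open>tilde P\<close> keeps \<open>P\<close> feasible and does not decrease the rate\<close>
        (\<exists>P. is_arg_max rate feas P \<and> diagonal_mat (tilde P)) \<and>
        (\<forall>P. feas P \<longrightarrow> feas (of_powers (diag_powers P)) \<and> rate P \<le> rate (of_powers (diag_powers P)))) \<and>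
       ((\<forall>p. tilde (of_powers p) = real_diag L2 p \<and>
             (feas (of_powers p) \<longleftrightarrow> feasible_powers L2 B p) \<and>
             (feasible_powers L2 B p \<longrightarrow> rate (of_powers p) = sum_rate L2 l p) \<and>
             (is_arg_max rate feas (of_powers p) \<longleftrightarrow>
              is_arg_max (sum_rate L2 l) (feasible_powers L2 B) p))) \<and>
       (\<comment> \<open>a saturating water level exists and is unique, unless all channel gains vanish\<close>
        K \<noteq> 0\<^sub>m N2 L2 \<longrightarrow> (\<exists>!\<beta>2. (\<Sum>n<L2. water \<beta>2 n) = B)) \<and>
       (\<forall>\<beta>2. (\<Sum>n<L2. water \<beta>2 n) = B \<longrightarrow>
          is_arg_max (sum_rate L2 l) (feasible_powers L2 B) (water \<beta>2) \<and>
          is_arg_max rate feas (of_powers (water \<beta>2)) \<and>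
          V2_OPA * P2_OPA \<beta>2 * V2_OPA\<^sup>H = V2 * of_powers (water \<beta>2) * V2\<^sup>H \<and>
          is_arg_max (tx_rate N2 D2 H22 V2_OPA) (feasible_cov L2 V2_OPA B) (P2_OPA \<beta>2) \<and>
          tx_rate N2 D2 H22 V2_OPA (P2_OPA \<beta>2) = rate (of_powers (water \<beta>2)))"
proof -
  let ?B = "real M2 * p2max" and ?V = "V2 * VK"
  let ?w = "\<lambda>\<beta> n. water_power \<beta> 1 (gram_diag \<Lambda>K n)"
  have l_eq: "l = gram_diag \<Lambda>K" using l by (rule ext)
  have B: "0 < ?B" using dims params by simp
  interpret sec: mimo_svd N2 M2 L2 D2 H22 V2 UK \<Lambda>K VK ?B
    using channels V2 D2 svdK
    by unfold_locales
      (auto simp: K L2 orthonormal_kernel_basis_def is_inv_sqrt_def psd_mat_def)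
  \<comment> \<open>Here \<open>VK\<close> has moved into the precoder. The right singular matrix is
    the identity, so diagonal covariances such as \<open>P2_OPA\<close> need no further change of
    basis, and the gains are still those of \<open>\<Lambda>K\<close>.\<close>
  interpret opa: mimo_svd N2 M2 L2 D2 H22 ?V UK \<Lambda>K "1\<^sub>m L2" ?B
  proof unfold_locales
    show "?V \<in> carrier_mat M2 L2" by (rule carrier_matI) (simp_all add: sec.dims)
    have "?V\<^sup>H * ?V = VK\<^sup>H * ((V2\<^sup>H * V2) * VK)"
      by (simp add: adjoint_mult mult_assoc_dim sec.dims)
    then show "?V\<^sup>H * ?V = 1\<^sub>m L2" using sec.V(2) sec.W by simp
    have "D2 * H22 * ?V = (D2 * H22 * V2) * VK"
      by (simp add: mult_assoc_dim sec.dims)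
    also have "\<dots> = UK * \<Lambda>K * (VK\<^sup>H * VK)"
      unfolding sec.K by (simp add: mult_assoc_dim sec.dims)
    finally show "is_svd N2 L2 (D2 * H22 * ?V) UK \<Lambda>K (1\<^sub>m L2)"
      using sec.svd sec.W(2) by (simp add: is_svd_def unitary_mat_def)
  qed (use channels sec.D in auto)
  have opa_powers: "1\<^sub>m L2 * real_diag L2 p * (1\<^sub>m L2)\<^sup>H = real_diag L2 p" for p
    by (simp add: left_mult_one_mat[OF real_diag_simps(1)] right_mult_one_mat[OF real_diag_simps(1)])
  have K_gain: "\<exists>!\<beta>2. (\<Sum>n<L2. ?w \<beta>2 n) = ?B" if "K \<noteq> 0\<^sub>m N2 L2"
    using sec.gain_nonzero that[unfolded K]
      water_level_ex1[of L2 "gram_diag \<Lambda>K" _ ?B, OF sec.gain_nonneg _ _ B] by blast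
  \<comment> \<open>The maximizer comes from the general existence result, since no water level
    saturates the constraint if \<open>K\<close> is zero.\<close>
  have opt: "\<exists>P. is_arg_max sec.rate sec.feas P \<and> diagonal_mat (sec.tilde P)"
  proof -
    obtain p where "is_arg_max (sum_rate L2 (gram_diag \<Lambda>K)) (feasible_powers L2 ?B) p"
      using sec.ex_arg_max[OF B] by blast
    then have "is_arg_max sec.rate sec.feas (sec.of_powers p)"
      by (simp only: sec.arg_max_of_powers)
    moreover have "diagonal_mat (sec.tilde (sec.of_powers p))"
      by (simp add: sec.tilde_of_powers diagonal_mat_def)
    ultimately show ?thesis by blast
  qed
  have water:
    "is_arg_max (sum_rate L2 (gram_diag \<Lambda>K)) (feasible_powers L2 ?B) (?w \<beta>2)
     \<and> is_arg_max sec.rate sec.feas (sec.of_powers (?w \<beta>2))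
     \<and> ?V * real_diag L2 (?w \<beta>2) * ?V\<^sup>H = V2 * sec.of_powers (?w \<beta>2) * V2\<^sup>H
     \<and> is_arg_max opa.rate opa.feas (real_diag L2 (?w \<beta>2))
     \<and> opa.rate (real_diag L2 (?w \<beta>2)) = sec.rate (sec.of_powers (?w \<beta>2))"
    if sat: "(\<Sum>n<L2. ?w \<beta>2 n) = ?B" for \<beta>2
  proof -
    have "is_arg_max (sum_rate L2 (gram_diag \<Lambda>K)) (feasible_powers L2 ?B) (?w \<beta>2)"
      by (rule water_filling_optimal[of L2 "gram_diag \<Lambda>K" ?B \<beta>2, OF sec.gain_nonneg B sat])
    moreover have "?V * real_diag L2 (?w \<beta>2) * ?V\<^sup>H = V2 * sec.of_powers (?w \<beta>2) * V2\<^sup>H"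
      by (simp add: adjoint_mult mult_assoc_dim sec.dims)
    \<comment> \<open>The two rates agree because both equal the sum rate of the same powers over
      the same gains.\<close>
    ultimately show ?thesis
      using sec.arg_max_of_powers[of "?w \<beta>2"] opa.arg_max_of_powers[of "?w \<beta>2"]
        sec.rate_of_powers[of "?w \<beta>2"] opa.rate_of_powers[of "?w \<beta>2"]
      by (simp add: opa_powers water_power_nonneg)
  qed
  have rate_of_powers: "sec.rate (sec.of_powers p) = sum_rate L2 (gram_diag \<Lambda>K) p"
    if "feasible_powers L2 ?B p" for p
    using that by (intro sec.rate_of_powers) (simp add: feasible_powers_def)
  show ?thesis
    unfolding Let_def l_eq
    using opt K_gain water rate_of_powers sec.feas_of_powers sec.feasible_diag_powers
      sec.rate_le_rate_diag sec.tilde_of_powers sec.arg_max_of_powers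
    by (intro conjI allI impI) blast+
qed

end
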